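(* Let $n\ge 2$ and $p<n$. For every $a_0>0$ there exists at least one positive convex entire solution $u$ of $\det D^2u=u^p$ on $\mathbb{R}^n$ with $u(0)=a_0$ and $Du(0)=0$. In particular, the equation $\det D^2u=u^p$ has infinitely many positive convex entire solutions on $\mathbb{R}^n$ that are pairwise affinely inequivalent. *)

theory Defs
  imports "HOL-Analysis.Analysis"
begin

definition MA_entire_solution ::
  "real \<Rightarrow> (real^'n \<Rightarrow> real) \<Rightarrow> (real^'n \<Rightarrow> real^'n) \<Rightarrow> (real^'n \<Rightarrow> real^'n^'n) \<Rightarrow> bool"
where
  "MA_entire_solution p u Du H \<longleftrightarrow>
     (\<forall>x. (u has_derivative (\<lambda>h. Du x \<bullet> h)) (at x)) \<and>
     (\<forall>x. (Du has_derivative (\<lambda>h. H x *v h)) (at x)) \<and>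
     continuous_on UNIV H \<and>
     (\<forall>x. det (H x) = (u x) powr p)"

definition pos_convex_entire_solution :: "real \<Rightarrow> (real^'n \<Rightarrow> real) \<Rightarrow> bool" where
  "pos_convex_entire_solution p u \<longleftrightarrow>
     (\<forall>x. u x > 0) \<and> convex_on UNIV u \<and> (\<exists>Du H. MA_entire_solution p u Du H)"

definition affinely_equivalent :: "(real^'n \<Rightarrow> real) \<Rightarrow> (real^'n \<Rightarrow> real) \<Rightarrow> bool" where
  "affinely_equivalent u v \<longleftrightarrow>
     (\<exists>(A::real^'n^'n) b. invertible A \<and> (\<forall>x. v x = u (A *v x + b)))"

end

theory Submission
  imports Defs
begin

text \<open>
  Put \<open>u x = g (\<bar>x\<bar>\<^sup>2 / 2)\<close> and \<open>\<phi> = g'\<close>. The Hessian of \<open>u\<close> is \<open>\<phi> I + \<phi>' x x\<^sup>T\<close>, so that with \<open>t = \<bar>x\<bar>\<^sup>2 / 2\<close>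
  the equation becomes \<open>\<phi>\<^sup>n + 2 t \<phi>\<^sup>n\<^sup>-\<^sup>1 \<phi>' = g\<^sup>p\<close> on \<open>t \<ge> 0\<close>. This says that \<open>\<phi>\<^sup>n\<close> is the radial mean of \<open>g\<^sup>p\<close>,
  i.e. \<open>\<phi>(t)\<^sup>n = \<integral> n s\<^sup>n\<^sup>-\<^sup>1 g(s\<^sup>2 t)\<^sup>p ds\<close> over \<open>[0, 1]\<close>, which is regular at \<open>t = 0\<close>. The resulting Volterra
  equation for \<open>g\<close> is solved on the whole half line by Picard iteration between the barriers \<open>a\<close> and
  \<open>a e\<^sup>c\<^sup>t\<close>; the upper barrier is preserved because \<open>p \<le> n\<close>. Since \<open>a\<close> is the minimum of \<open>u\<close> and the range
  of a function is an affine invariant, different \<open>a\<close> give inequivalent solutions.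
\<close>

section \<open>Calculus on half lines and Volterra integral equations\<close>

lemma continuous_on_atLeast_if_segments:
  fixes f :: "real \<Rightarrow> 'a::topological_space"
  assumes "\<And>T. T > a \<Longrightarrow> continuous_on {a..T} f"
  shows "continuous_on {a..} f"
proof (clarsimp simp: continuous_on_eq_continuous_within)
  fix t assume t: "a \<le> t"
  have "continuous (at t within {a..t+1}) f"
    using assms[of "t+1"] t by (auto simp: continuous_on_eq_continuous_within)
  \<comment> \<open>The two sets coincide on the neighbourhood \<open>{..<t+1}\<close> of
    \<open>t\<close>.\<close>
  moreover have "at t within {a..t+1} = at t within {a..}"
    by (rule at_within_nhd[of _ "{..<t+1}"]) auto
  ultimately show "continuous (at t within {a..}) f" by simp
qed

lemma has_real_derivative_integral_atLeast:
  fixes f :: "real \<Rightarrow> real"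
  assumes "continuous_on {a..} f" "a \<le> t"
  shows "((\<lambda>x. integral {a..x} f) has_real_derivative f t) (at t within {a..})"
proof -
  have "((\<lambda>x. integral {a..x} f) has_real_derivative f t) (at t within {a..t+1})"
    using assms by (intro integral_has_real_derivative) (auto intro: continuous_on_subset)
  moreover have "at t within {a..t+1} = at t within {a..}"
    by (rule at_within_nhd[of _ "{..<t+1}"]) auto
  ultimately show ?thesis by simp
qed

lemma has_integral_exp_scaled:
  fixes c t :: real
  assumes "c \<noteq> 0" "t \<ge> 0"
  shows "((\<lambda>s. exp (c * s)) has_integral (exp (c * t) - 1) / c) {0..t}"
proof -
  have "((\<lambda>s. exp (c * s)) has_integral exp (c * t) / c - exp (c * 0) / c) {0..t}"
    using assms
    by (intro fundamental_theorem_of_calculus)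
       (auto intro!: derivative_eq_intros simp flip: has_real_derivative_iff_has_vector_derivative)
  then show ?thesis by (simp add: diff_divide_distrib)
qed

text \<open>Picard iteration. The Lipschitz hypothesis is causal: \<open>F g t\<close> and
  \<open>F h t\<close> are compared through \<open>g\<close> and \<open>h\<close> on
  \<open>{0..t}\<close> only, so an exponential weight yields a contraction on every
  \<open>{0..T}\<close>, however large the constant for that \<open>T\<close>. In the application
  \<open>K\<close> consists of the functions between two barriers; its invariance keeps the iterates
  where \<open>F\<close> is well behaved, and its closedness puts the limit there too.\<close>

lemma volterra_fixed_point:
  fixes F :: "(real \<Rightarrow> real) \<Rightarrow> real \<Rightarrow> real" and a :: real
  assumes start: "g0 \<in> K"
    and cont: "\<And>g. g \<in> K \<Longrightarrow> continuous_on {0..} g"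
    and contF: "\<And>g. g \<in> K \<Longrightarrow> continuous_on {0..} (F g)"
    and inv: "\<And>g. g \<in> K \<Longrightarrow> (\<lambda>t. a + integral {0..t} (F g)) \<in> K"
    and closed: "\<And>f g. (\<And>k. f k \<in> K) \<Longrightarrow> (\<And>T. uniform_limit {0..T} f g sequentially) \<Longrightarrow> g \<in> K"
    and lip: "\<And>T. T \<ge> 0 \<Longrightarrow> \<exists>L. \<forall>g\<in>K. \<forall>h\<in>K. \<forall>t\<in>{0..T}. \<forall>D.
                 (\<forall>s\<in>{0..t}. \<bar>g s - h s\<bar> \<le> D) \<longrightarrow> \<bar>F g t - F h t\<bar> \<le> L * D"
  shows "\<exists>g\<in>K. \<forall>t\<ge>0. g t = a + integral {0..t} (F g)"
proof -
  define f where "f k = ((\<lambda>g t. a + integral {0..t} (F g)) ^^ k) g0" for k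
  have f_Suc: "f (Suc k) t = a + integral {0..t} (F (f k))" for k t
    by (simp add: f_def)
  have fK: "f k \<in> K" for k
    by (induction k) (auto simp: f_def start inv)
  have intF: "F g integrable_on {0..t}" if "g \<in> K" for g t
    by (rule integrable_continuous_real, rule continuous_on_subset[OF contF[OF that]]) auto
  \<comment> \<open>Writing the limit as a telescoping series makes the M-test applicable and gives
    one function that serves all \<open>T\<close> at once.\<close>
  define G where "G t = f 0 t + (\<Sum>k. f (Suc k) t - f k t)" for t
  \<comment> \<open>Enlarging the constant to \<open>\<bar>L\<bar> + 1\<close> makes it positive, so
    that dividing by \<open>2 * L\<close> is allowed below.\<close>
  have lip': "\<exists>L>0. \<forall>g\<in>K. \<forall>h\<in>K. \<forall>t\<in>{0..T}. \<forall>D\<ge>0.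
                 (\<forall>s\<in>{0..t}. \<bar>g s - h s\<bar> \<le> D) \<longrightarrow> \<bar>F g t - F h t\<bar> \<le> L * D" if T0: "T \<ge> 0" for T
  proof -
    obtain L where L: "\<forall>g\<in>K. \<forall>h\<in>K. \<forall>t\<in>{0..T}. \<forall>D.
                 (\<forall>s\<in>{0..t}. \<bar>g s - h s\<bar> \<le> D) \<longrightarrow> \<bar>F g t - F h t\<bar> \<le> L * D"
      using lip[OF T0] by blast
    have "L * D \<le> (\<bar>L\<bar> + 1) * D" if "D \<ge> 0" for D
      using that by (intro mult_right_mono) auto
    with L have "\<forall>g\<in>K. \<forall>h\<in>K. \<forall>t\<in>{0..T}. \<forall>D\<ge>0.
                 (\<forall>s\<in>{0..t}. \<bar>g s - h s\<bar> \<le> D) \<longrightarrow> \<bar>F g t - F h t\<bar> \<le> (\<bar>L\<bar> + 1) * D"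
      by (meson order_trans)
    then show ?thesis
      by (intro exI[of _ "\<bar>L\<bar> + 1"]) simp
  qed
  have lim: "uniform_limit {0..T} f G sequentially" for T
  proof (cases "T \<ge> 0")
    case True
    from lip'[OF True] obtain L where "L > 0" and L: "\<And>g h t D. g \<in> K \<Longrightarrow> h \<in> K \<Longrightarrow> t \<in> {0..T} \<Longrightarrow> D \<ge> 0 \<Longrightarrow>
         (\<forall>s\<in>{0..t}. \<bar>g s - h s\<bar> \<le> D) \<Longrightarrow> \<bar>F g t - F h t\<bar> \<le> L * D" by blast
    have "continuous_on {0..T} (\<lambda>t. f 1 t - f 0 t)"
      by (intro continuous_intros continuous_on_subset[OF cont[OF fK]]) auto
    then have "bounded ((\<lambda>t. f 1 t - f 0 t) ` {0..T})"
      by (intro compact_imp_bounded compact_continuous_image) auto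
    then obtain D where D: "\<And>t. t \<in> {0..T} \<Longrightarrow> \<bar>f 1 t - f 0 t\<bar> \<le> D"
      unfolding bounded_iff by (metis imageI real_norm_def)
    have "D \<ge> 0" using D[of 0] True by auto
    \<comment> \<open>The weight \<open>exp (2 * L * t)\<close> turns the Volterra operator into a contraction with factor 1/2.\<close>
    have step: "\<bar>f (Suc k) t - f k t\<bar> \<le> D * exp (2 * L * t) / 2 ^ k" if "t \<in> {0..T}" for k t
      using that
    proof (induction k arbitrary: t)
      case 0
      have "D * 1 \<le> D * exp (2 * L * t)"
        using 0 \<open>L > 0\<close> \<open>D \<ge> 0\<close> by (intro mult_left_mono) auto
      then show ?case using D[OF 0] by simp
    next
      case (Suc k)
      have *: "\<bar>F (f (Suc k)) s - F (f k) s\<bar> \<le> L * (D * exp (2 * L * s) / 2 ^ k)" if "s \<in> {0..t}" for s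
      proof (rule L[OF fK fK])
        show "\<forall>r\<in>{0..s}. \<bar>f (Suc k) r - f k r\<bar> \<le> D * exp (2 * L * s) / 2 ^ k"
        proof
          fix r assume r: "r \<in> {0..s}"
          have "\<bar>f (Suc k) r - f k r\<bar> \<le> D * exp (2 * L * r) / 2 ^ k"
            using r that Suc.prems by (intro Suc.IH) auto
          also have "\<dots> \<le> D * exp (2 * L * s) / 2 ^ k"
            using r \<open>L > 0\<close> \<open>D \<ge> 0\<close> by (intro divide_right_mono mult_left_mono) auto
          finally show "\<bar>f (Suc k) r - f k r\<bar> \<le> D * exp (2 * L * s) / 2 ^ k" .
        qed
      qed (use that Suc.prems \<open>D \<ge> 0\<close> in auto)
      have ex: "((\<lambda>s. L * D / 2 ^ k * exp (2 * L * s)) has_integral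
                  L * D / 2 ^ k * ((exp (2 * L * t) - 1) / (2 * L))) {0..t}"
        using Suc.prems \<open>L > 0\<close> by (intro has_integral_mult_right has_integral_exp_scaled) auto
      have "f (Suc (Suc k)) t - f (Suc k) t = integral {0..t} (\<lambda>s. F (f (Suc k)) s - F (f k) s)"
        using intF[OF fK] by (simp add: f_Suc[of "Suc k"] f_Suc[of k] integral_diff)
      also have "norm \<dots> \<le> integral {0..t} (\<lambda>s. L * D / 2 ^ k * exp (2 * L * s))"
        using * intF[OF fK] has_integral_integrable[OF ex]
        by (intro integral_norm_bound_integral integrable_diff) (auto simp: mult.assoc)
      also have "\<dots> = D * (exp (2 * L * t) - 1) / 2 ^ Suc k"
        unfolding integral_unique[OF ex] using \<open>L > 0\<close> by (simp add: field_simps)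
      also have "\<dots> \<le> D * exp (2 * L * t) / 2 ^ Suc k"
        using \<open>D \<ge> 0\<close> by (intro divide_right_mono mult_left_mono) auto
      finally show ?case by simp
    qed
    have "uniform_limit {0..T} (\<lambda>n t. \<Sum>k<n. f (Suc k) t - f k t) (\<lambda>t. \<Sum>k. f (Suc k) t - f k t) sequentially"
    proof (rule Weierstrass_m_test)
      show "norm (f (Suc k) t - f k t) \<le> D * exp (2 * L * T) * (1/2) ^ k" if "t \<in> {0..T}" for k t
      proof -
        have "D * exp (2 * L * t) / 2 ^ k \<le> D * exp (2 * L * T) / 2 ^ k"
          using that \<open>L > 0\<close> \<open>D \<ge> 0\<close> by (intro divide_right_mono mult_left_mono) auto
        then show ?thesis using step[OF that, of k] by (simp add: power_one_over field_simps)
      qed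
      show "summable (\<lambda>k. D * exp (2 * L * T) * (1/2) ^ k)"
        by (intro summable_mult summable_geometric) auto
    qed
    moreover have telescope: "(\<Sum>k<n. f (Suc k) t - f k t) = f n t - f 0 t" for n t
      by (induction n) auto
    ultimately have "uniform_limit {0..T} (\<lambda>n t. f n t - f 0 t) (\<lambda>t. \<Sum>k. f (Suc k) t - f k t) sequentially"
      by (simp add: telescope)
    then have "uniform_limit {0..T} (\<lambda>n t. f 0 t + (f n t - f 0 t)) (\<lambda>t. f 0 t + (\<Sum>k. f (Suc k) t - f k t)) sequentially"
      by (intro uniform_limit_add uniform_limit_const)
    then show ?thesis by (simp add: G_def[abs_def])
  \<comment> \<open>For \<open>T < 0\<close> the interval is empty.\<close>
  qed (auto simp: uniform_limit_iff)
  have GK: "G \<in> K" using closed[OF fK lim] .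
  have "G t = a + integral {0..t} (F G)" if t: "t \<ge> 0" for t
  proof -
    from lip'[OF t] obtain L where "L > 0" and L: "\<And>g h s D. g \<in> K \<Longrightarrow> h \<in> K \<Longrightarrow> s \<in> {0..t} \<Longrightarrow> D \<ge> 0 \<Longrightarrow>
         (\<forall>r\<in>{0..s}. \<bar>g r - h r\<bar> \<le> D) \<Longrightarrow> \<bar>F g s - F h s\<bar> \<le> L * D" by blast
    have "uniform_limit {0..t} (\<lambda>k. F (f k)) (F G) sequentially"
    proof (rule uniform_limitI)
      fix e :: real assume "e > 0"
      then have "\<forall>\<^sub>F k in sequentially. \<forall>s\<in>{0..t}. dist (f k s) (G s) < e / (2 * L)"
        using uniform_limitD[OF lim, of "e / (2 * L)" t] \<open>L > 0\<close> by simp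
      then show "\<forall>\<^sub>F k in sequentially. \<forall>s\<in>{0..t}. dist (F (f k) s) (F G s) < e"
      proof (eventually_elim, intro ballI)
        fix k s assume k: "\<forall>s\<in>{0..t}. dist (f k s) (G s) < e / (2 * L)" and s: "s \<in> {0..t}"
        have "\<bar>F (f k) s - F G s\<bar> \<le> L * (e / (2 * L))"
          using k s \<open>e > 0\<close> \<open>L > 0\<close> by (intro L[OF fK GK]) (auto simp: dist_real_def less_imp_le)
        then show "dist (F (f k) s) (F G s) < e"
          using \<open>e > 0\<close> \<open>L > 0\<close> by (simp add: dist_real_def)
      qed
    qed
    moreover have "continuous_on {0..t} (F (f k))" for k
      by (rule continuous_on_subset[OF contF[OF fK]]) auto
    ultimately obtain I J where IJ: "\<And>k. (F (f k) has_integral I k) {0..t}" "(F G has_integral J) {0..t}" "I \<longlonglongrightarrow> J"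
      by (rule uniform_limit_integral) auto
    have "(\<lambda>k. a + integral {0..t} (F (f k))) \<longlonglongrightarrow> a + integral {0..t} (F G)"
      using IJ(3) integral_unique[OF IJ(1)] integral_unique[OF IJ(2)] by (auto intro: tendsto_intros)
    moreover have "(\<lambda>k. f (Suc k) t) \<longlonglongrightarrow> G t"
      using tendsto_uniform_limitI[OF lim, of t t] t LIMSEQ_Suc by fastforce
    ultimately show ?thesis
      by (simp add: f_Suc LIMSEQ_unique)
  qed
  then show ?thesis using GK by blast
qed

section \<open>Radial means\<close>

text \<open>The average of \<open>h (\<bar>y\<bar>\<^sup>2 / 2)\<close> over the ball \<open>\<bar>y\<bar>\<^sup>2 / 2 \<le> t\<close> in \<open>n\<close>-dimensional space, in polar coordinates.\<close>

definition radial_mean :: "nat \<Rightarrow> (real \<Rightarrow> real) \<Rightarrow> real \<Rightarrow> real" where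
  "radial_mean n h t = integral {0..1} (\<lambda>s. real n * s ^ (n - 1) * h (s\<^sup>2 * t))"

lemma continuous_on_radial_mean_kernel:
  assumes "continuous_on {0..} h"
  shows "continuous_on ({0..} \<times> {0..1}) (\<lambda>(t, s). real n * s ^ (n - 1) * h (s\<^sup>2 * t))"
  unfolding case_prod_unfold
  by (intro continuous_intros continuous_on_compose2[OF assms]) auto

lemma radial_mean_integrable:
  assumes "continuous_on {0..} h" "t \<ge> 0"
  shows "(\<lambda>s. real n * s ^ (n - 1) * h (s\<^sup>2 * t)) integrable_on {0..1}"
  using assms(2) by (intro integrable_continuous_real continuous_intros continuous_on_compose2[OF assms(1)]) auto

lemma continuous_on_radial_mean:
  assumes "continuous_on {0..} h"
  shows "continuous_on {0..} (radial_mean n h)"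
proof -
  have "continuous_on {0..} (\<lambda>t. integral (cbox 0 1) (\<lambda>s. real n * s ^ (n - 1) * h (s\<^sup>2 * t)))"
    by (rule integral_continuous_on_param) (use continuous_on_radial_mean_kernel[OF assms] in simp)
  then show ?thesis by (simp add: radial_mean_def[abs_def])
qed

lemma radial_mean_const:
  assumes "n > 0"
  shows "radial_mean n (\<lambda>_. c) t = c"
proof -
  have "((\<lambda>s. real n * s ^ (n - 1) * c) has_integral 1 ^ n * c - 0 ^ n * c) {0..1::real}"
    by (intro fundamental_theorem_of_calculus)
       (auto intro!: derivative_eq_intros simp flip: has_real_derivative_iff_has_vector_derivative)
  then have "radial_mean n (\<lambda>_. c) t = 1 ^ n * c - 0 ^ n * c"
    unfolding radial_mean_def by (rule integral_unique)
  with assms show ?thesis by (simp add: power_0_left)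
qed

lemma radial_mean_mono:
  assumes "continuous_on {0..} h" "continuous_on {0..} k" "t \<ge> 0"
    and "\<And>s. s \<in> {0..t} \<Longrightarrow> h s \<le> k s"
  shows "radial_mean n h t \<le> radial_mean n k t"
  unfolding radial_mean_def
proof (rule integral_le)
  fix s :: real assume "s \<in> {0..1}"
  then have "s\<^sup>2 * t \<in> {0..t}" using assms(3) by (auto intro!: mult_left_le_one_le power_le_one)
  with assms(4) \<open>s \<in> {0..1}\<close>
  show "real n * s ^ (n - 1) * h (s\<^sup>2 * t) \<le> real n * s ^ (n - 1) * k (s\<^sup>2 * t)"
    by (intro mult_left_mono) auto
qed (use assms radial_mean_integrable in auto)

lemma radial_mean_bounds:
  assumes "n > 0" "continuous_on {0..} h" "t \<ge> 0"
    and "\<And>s. s \<in> {0..t} \<Longrightarrow> c \<le> h s \<and> h s \<le> d"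
  shows "radial_mean n h t \<in> {c..d}"
  using radial_mean_mono[of "\<lambda>_. c" h t n] radial_mean_mono[of h "\<lambda>_. d" t n] assms
  by (auto simp: radial_mean_const)

lemma radial_mean_diff:
  assumes "continuous_on {0..} h" "continuous_on {0..} k" "t \<ge> 0"
  shows "radial_mean n (\<lambda>s. h s - k s) t = radial_mean n h t - radial_mean n k t"
  using integral_diff[OF radial_mean_integrable[OF assms(1,3)] radial_mean_integrable[OF assms(2,3)], of n n]
  by (simp add: radial_mean_def right_diff_distrib)

lemma radial_mean_dist:
  assumes "n > 0" "continuous_on {0..} h" "continuous_on {0..} k" "t \<ge> 0"
    and "\<And>s. s \<in> {0..t} \<Longrightarrow> \<bar>h s - k s\<bar> \<le> D"
  shows "\<bar>radial_mean n h t - radial_mean n k t\<bar> \<le> D"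
  using radial_mean_bounds[of n "\<lambda>s. h s - k s" t "-D" D] assms
  by (fastforce simp: radial_mean_diff abs_le_iff intro!: continuous_intros)

text \<open>Differentiation under the integral sign. The inner derivative \<open>s\<^sup>2\<close>
  turns the weight \<open>s ^ (n - 1)\<close> into \<open>s ^ (n + 1)\<close>, the weight of the
  mean in dimension \<open>n + 2\<close>; the factor \<open>n / (n + 2)\<close> adjusts the
  normalisation.\<close>

lemma radial_mean_has_derivative:
  assumes h: "\<And>t. t \<ge> 0 \<Longrightarrow> (h has_real_derivative h' t) (at t within {0..})"
    and h': "continuous_on {0..} h'" and "n > 0" "t \<ge> 0"
  shows "(radial_mean n h has_real_derivative real n / (n + 2) * radial_mean (n + 2) h' t) (at t within {0..})"
proof -
  have h_cont: "continuous_on {0..} h"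
    using h by (intro DERIV_continuous_on) auto
  have deriv: "((\<lambda>t. integral (cbox 0 1) (\<lambda>s. real n * s ^ (n - 1) * h (s\<^sup>2 * t))) has_real_derivative
         integral (cbox 0 1) (\<lambda>s. real n * s ^ (n - 1) * (h' (s\<^sup>2 * t) * s\<^sup>2))) (at t within {0..})"
  proof (rule leibniz_rule_field_derivative)
    fix x s :: real assume x: "x \<in> {0..}" and s: "s \<in> cbox 0 1"
    have "((\<lambda>x. h (s\<^sup>2 * x)) has_real_derivative h' (s\<^sup>2 * x) * s\<^sup>2) (at x within {0..})"
    proof -
      \<comment> \<open>Differentiating within the image of the half line covers
        \<open>s = 0\<close> as well, where that image is \<open>{0}\<close>.\<close>
      have 1: "(h has_real_derivative h' (s\<^sup>2 * x)) (at (s\<^sup>2 * x) within (*) (s\<^sup>2) ` {0..})"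
        using x by (intro has_field_derivative_subset[OF h]) auto
      have 2: "((*) (s\<^sup>2) has_real_derivative s\<^sup>2) (at x within {0..})"
        by (auto intro!: derivative_eq_intros)
      from DERIV_image_chain[OF 1 2] show ?thesis by (simp add: o_def)
    qed
    then show "((\<lambda>x. real n * s ^ (n - 1) * h (s\<^sup>2 * x)) has_real_derivative
                 real n * s ^ (n - 1) * (h' (s\<^sup>2 * x) * s\<^sup>2)) (at x within {0..})"
      by (rule DERIV_cmult)
  next
    show "continuous_on ({0..} \<times> cbox 0 1) (\<lambda>(x, s). real n * s ^ (n - 1) * (h' (s\<^sup>2 * x) * s\<^sup>2))"
      unfolding case_prod_unfold
      by (intro continuous_intros continuous_on_compose2[OF h']) auto
  qed (use assms radial_mean_integrable[OF h_cont] in auto)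
  have eq: "real n * s ^ (n - 1) * (h' (s\<^sup>2 * t) * s\<^sup>2)
                  = real n / (n + 2) * (real (n + 2) * s ^ (n + 2 - 1) * h' (s\<^sup>2 * t))" for s
    using \<open>n > 0\<close> by (cases n) (simp_all add: power2_eq_square)
  have "integral {0..1} (\<lambda>s. real n * s ^ (n - 1) * (h' (s\<^sup>2 * t) * s\<^sup>2)) = real n / (n + 2) * radial_mean (n + 2) h' t"
    unfolding radial_mean_def eq by (rule integral_mult_right)
  moreover have "radial_mean n h = (\<lambda>t. integral {0..1} (\<lambda>s. real n * s ^ (n - 1) * h (s\<^sup>2 * t)))"
    by (simp add: radial_mean_def fun_eq_iff)
  ultimately show ?thesis using deriv by simp
qed

text \<open>Integrate the \<open>s\<close>-derivative of \<open>s ^ n * h (s\<^sup>2 * t)\<close>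
  over \<open>{0..1}\<close>: the product rule yields the two means, the endpoint \<open>1\<close>
  yields \<open>h t\<close>. By the derivative formula for the mean, the identity is the first order
  equation \<open>A + (2 * t / n) * A' = h\<close> for \<open>A = radial_mean n h\<close>.\<close>

lemma radial_mean_ode:
  assumes h: "\<And>t. t \<ge> 0 \<Longrightarrow> (h has_real_derivative h' t) (at t within {0..})"
    and h': "continuous_on {0..} h'" and "n > 0" "t \<ge> 0"
  shows "radial_mean n h t + 2 * t / (n + 2) * radial_mean (n + 2) h' t = h t"
proof -
  have h_cont: "continuous_on {0..} h"
    using h by (intro DERIV_continuous_on) auto
  let ?I = "\<lambda>s. real n * s ^ (n - 1) * h (s\<^sup>2 * t) + 2 * t / (n + 2) * (real (n + 2) * s ^ (n + 2 - 1) * h' (s\<^sup>2 * t))"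
  have "(?I has_integral 1 ^ n * h (1\<^sup>2 * t) - 0 ^ n * h (0\<^sup>2 * t)) {0..1}"
  proof (rule fundamental_theorem_of_calculus)
    fix s :: real assume s: "s \<in> {0..1}"
    have 1: "(h has_real_derivative h' (s\<^sup>2 * t)) (at (s\<^sup>2 * t) within (\<lambda>s. s\<^sup>2 * t) ` {0..1})"
      using \<open>t \<ge> 0\<close> by (intro has_field_derivative_subset[OF h]) auto
    have 2: "((\<lambda>s. s\<^sup>2 * t) has_real_derivative 2 * s * t) (at s within {0..1})"
      by (auto intro!: derivative_eq_intros)
    have "((\<lambda>s. h (s\<^sup>2 * t)) has_real_derivative h' (s\<^sup>2 * t) * (2 * s * t)) (at s within {0..1})"
      using DERIV_image_chain[OF 1 2] by (simp add: o_def)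
    then have "((\<lambda>s. s ^ n * h (s\<^sup>2 * t)) has_real_derivative
        real n * s ^ (n - 1) * h (s\<^sup>2 * t) + h' (s\<^sup>2 * t) * (2 * s * t) * s ^ n) (at s within {0..1})"
      by (rule DERIV_mult[rotated]) (auto intro!: derivative_eq_intros)
    moreover have "h' (s\<^sup>2 * t) * (2 * s * t) * s ^ n = 2 * t / (n + 2) * (real (n + 2) * s ^ (n + 2 - 1) * h' (s\<^sup>2 * t))"
      by simp
    ultimately show "((\<lambda>s. s ^ n * h (s\<^sup>2 * t)) has_vector_derivative ?I s) (at s within {0..1})"
      by (simp add: has_real_derivative_iff_has_vector_derivative)
  qed simp
  \<comment> \<open>The boundary term at \<open>s = 0\<close> vanishes because
    \<open>0 ^ n = 0\<close> for \<open>n > 0\<close>.\<close>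
  then have "(?I has_integral h t) {0..1}"
    using \<open>n > 0\<close> by (simp add: power_0_left)
  moreover have "(?I has_integral radial_mean n h t + 2 * t / (n + 2) * radial_mean (n + 2) h' t) {0..1}"
    unfolding radial_mean_def
    by (rule has_integral_add[OF integrable_integral[OF radial_mean_integrable[OF h_cont \<open>t \<ge> 0\<close>]]
          has_integral_mult_right[OF integrable_integral[OF radial_mean_integrable[OF h' \<open>t \<ge> 0\<close>]]]])
  ultimately show ?thesis by (rule has_integral_unique[symmetric])
qed

section \<open>Global solution of the radial equation\<close>

text \<open>Staying above \<open>a > 0\<close> bounds the derivative of the power for either sign of
  \<open>q\<close>. Applied below with the exponents \<open>p\<close> and
  \<open>1 / n\<close>.\<close>

lemma powr_lipschitz_on_interval:
  fixes a b q :: real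
  assumes "0 < a"
  shows "\<exists>L\<ge>0. \<forall>x\<in>{a..b}. \<forall>y\<in>{a..b}. \<bar>x powr q - y powr q\<bar> \<le> L * \<bar>x - y\<bar>"
proof -
  have "continuous_on {a..b} (\<lambda>x. q * x powr (q - 1))"
    using assms by (auto intro!: continuous_intros)
  then have "bounded ((\<lambda>x. q * x powr (q - 1)) ` {a..b})"
    by (intro compact_imp_bounded compact_continuous_image) auto
  then obtain L where "L > 0" and L: "\<And>x. x \<in> {a..b} \<Longrightarrow> norm (q * x powr (q - 1)) \<le> L"
    unfolding bounded_pos by (metis imageI)
  have "norm (x powr q - y powr q) \<le> L * norm (x - y)" if "x \<in> {a..b}" "y \<in> {a..b}" for x y
  proof (rule field_differentiable_bound[where S = "{a..b}" and f' = "\<lambda>x. q * x powr (q - 1)"])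
    fix z assume "z \<in> {a..b}"
    then show "((\<lambda>x. x powr q) has_real_derivative q * z powr (q - 1)) (at z within {a..b})"
      using assms by (intro has_field_derivative_at_within[OF has_real_derivative_powr]) auto
  qed (use that L in auto)
  then show ?thesis
    using \<open>L > 0\<close> by (auto intro!: exI[of _ L])
qed

text \<open>The fixed point theorem is applied to \<open>g' = F g\<close>, where \<open>F g\<close>
  is the \<open>n\<close>-th root of the radial mean of \<open>g powr p\<close>. The fixed point
  only provides \<open>g\<close> and \<open>\<phi> = F g\<close>; differentiability of
  \<open>\<phi>\<close> is recovered afterwards from the formula for the derivative of a
  mean.\<close>

lemma radial_ode_existence:
  fixes p a :: real and n :: nat
  assumes n: "n > 0" and pn: "p \<le> n" and a: "a > 0"
  shows "\<exists>g \<phi> \<psi>. g 0 = a \<and> continuous_on {0..} \<psi> \<and>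
    (\<forall>t\<ge>0. a \<le> g t \<and> 0 < \<phi> t \<and>
       (g has_real_derivative \<phi> t) (at t within {0..}) \<and>
       (\<phi> has_real_derivative \<psi> t) (at t within {0..}) \<and>
       \<phi> t ^ (n - 1) * (\<phi> t + 2 * t * \<psi> t) = g t powr p)"
proof -
  define c where "c = a powr (p / n - 1)"
  \<comment> \<open>By this choice of \<open>c\<close>, \<open>g \<le> a * exp (c * t)\<close> implies \<open>F g \<le> (a * exp (c * t))'\<close>.\<close>
  define K where "K = {g. continuous_on {0..} g \<and> (\<forall>t\<ge>0. a \<le> g t \<and> g t \<le> a * exp (c * t))}"
  define A where "A g = radial_mean n (\<lambda>t. g t powr p)" for g
  define F where "F g t = A g t powr (1 / n)" for g t
  have c: "c > 0" using a by (simp add: c_def)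
  have ac: "a powr (p / n) = a * c"
    using a by (simp add: c_def powr_diff)
  have K_cont: "continuous_on {0..} g" and K_lower: "t \<ge> 0 \<Longrightarrow> a \<le> g t" and K_upper: "t \<ge> 0 \<Longrightarrow> g t \<le> a * exp (c * t)"
    if "g \<in> K" for g t
    using that by (auto simp: K_def)
  have powr_cont: "continuous_on {0..} (\<lambda>t. g t powr p)" if "g \<in> K" for g
    using K_lower[OF that] a by (intro continuous_intros K_cont[OF that]) force
  \<comment> \<open>The sign of \<open>p\<close> is open, so \<open>x powr p\<close> may rise or
    fall on \<open>{a..M}\<close>; its extremes are the endpoint values, in unknown order.\<close>
  have powr_lower: "min (a powr p) (M powr p) \<le> x powr p" if "a \<le> x" "x \<le> M" for x M :: real
    using that a by (cases "p \<ge> 0") (auto intro: powr_mono2 powr_mono2' simp: min_le_iff_disj)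
  have powr_upper: "x powr p \<le> max (a powr p) (M powr p)" if "a \<le> x" "x \<le> M" for x M :: real
    using that a by (cases "p \<ge> 0") (auto intro: powr_mono2 powr_mono2' simp: le_max_iff_disj)
  have A_bounds: "A g t \<in> {min (a powr p) (M powr p)..max (a powr p) (M powr p)}"
    if "g \<in> K" "t \<ge> 0" "a * exp (c * t) \<le> M" for g t M
    unfolding A_def
  proof (rule radial_mean_bounds[OF n powr_cont])
    fix s assume s: "s \<in> {0..t}"
    have "g s \<le> a * exp (c * s)" using K_upper[OF that(1)] s by auto
    also have "\<dots> \<le> a * exp (c * t)" using s a c by auto
    finally have "g s \<le> M" using that(3) by linarith
    then show "min (a powr p) (M powr p) \<le> g s powr p \<and> g s powr p \<le> max (a powr p) (M powr p)"
      using powr_lower powr_upper K_lower[OF that(1)] s by auto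
  qed (use that in auto)
  have A_pos: "A g t > 0" if "g \<in> K" "t \<ge> 0" for g t
  proof -
    have "min (a powr p) ((a * exp (c * t)) powr p) > 0" using a by auto
    also have "\<dots> \<le> A g t" using A_bounds[OF that order_refl] unfolding atLeastAtMost_iff by blast
    finally show ?thesis .
  qed
  have F_cont: "continuous_on {0..} (F g)" if "g \<in> K" for g
    unfolding F_def using A_pos[OF that] continuous_on_radial_mean[OF powr_cont[OF that], of n]
    by (intro continuous_intros) (force simp: A_def[abs_def])+
  \<comment> \<open>Here \<open>p \<le> n\<close> enters: the power \<open>p\<close> of the upper
    barrier grows at most like \<open>exp (c * t * n)\<close>, whose \<open>n\<close>-th root is
    \<open>exp (c * t)\<close>.\<close>
  have F_le: "F g t \<le> a * c * exp (c * t)" if "g \<in> K" "t \<ge> 0" for g t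
  proof -
    have "(a * exp (c * t)) powr p = a powr p * exp (c * t * p)"
      using a by (simp add: powr_mult exp_powr_real)
    also have "\<dots> \<le> a powr p * exp (c * t * n)"
      using pn c that by (intro mult_left_mono) (auto intro!: mult_left_mono)
    finally have "(a * exp (c * t)) powr p \<le> a powr p * exp (c * t * n)" .
    \<comment> \<open>For negative \<open>p\<close> the maximum in \<open>A_bounds\<close> is
      \<open>a powr p\<close>, so this endpoint has to be dominated too.\<close>
    moreover have "a powr p * 1 \<le> a powr p * exp (c * t * n)"
      using c that by (intro mult_left_mono) auto
    ultimately have "A g t \<le> a powr p * exp (c * t * n)"
      using A_bounds[OF that order_refl] by auto
    then have "F g t \<le> (a powr p * exp (c * t * n)) powr (1 / n)"
      using A_pos[OF that] unfolding F_def by (intro powr_mono2) auto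
    also have "\<dots> = a powr (p / n) * exp (c * t)"
      using n a by (simp add: powr_mult powr_powr exp_powr_real)
    finally show ?thesis by (simp add: ac)
  qed
  have "\<exists>g\<in>K. \<forall>t\<ge>0. g t = a + integral {0..t} (F g)"
  proof (rule volterra_fixed_point[where ?g0.0 = "\<lambda>_. a"])
    show "(\<lambda>_. a) \<in> K" using a c by (auto simp: K_def)
    show "(\<lambda>t. a + integral {0..t} (F g)) \<in> K" if g: "g \<in> K" for g
      unfolding K_def
    proof (intro CollectI conjI allI impI)
      show "continuous_on {0..} (\<lambda>t. a + integral {0..t} (F g))"
        by (intro continuous_intros DERIV_continuous_on[OF has_real_derivative_integral_atLeast[OF F_cont[OF g]]]) auto
      fix t :: real assume t: "t \<ge> 0"
      have int: "F g integrable_on {0..t}"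
        by (rule integrable_continuous_real, rule continuous_on_subset[OF F_cont[OF g]]) auto
      show "a \<le> a + integral {0..t} (F g)"
        using integral_nonneg[OF int] by (auto simp: F_def)
      have ex: "((\<lambda>s. a * c * exp (c * s)) has_integral a * c * ((exp (c * t) - 1) / c)) {0..t}"
        using t c by (intro has_integral_mult_right has_integral_exp_scaled) auto
      have "integral {0..t} (F g) \<le> integral {0..t} (\<lambda>s. a * c * exp (c * s))"
        using F_le[OF g] by (intro integral_le int has_integral_integrable[OF ex]) auto
      also have "\<dots> = a * exp (c * t) - a"
        unfolding integral_unique[OF ex] using c by (simp add: field_simps)
      finally show "a + integral {0..t} (F g) \<le> a * exp (c * t)" by simp
    qed
    show "g \<in> K" if f: "\<And>k. f k \<in> K" and lim: "\<And>T. uniform_limit {0..T} f g sequentially" for f g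
      unfolding K_def
    proof (intro CollectI conjI allI impI)
      show "continuous_on {0..} g"
      proof (rule continuous_on_atLeast_if_segments)
        show "continuous_on {0..T} g" for T
          by (rule uniform_limit_theorem[OF _ lim])
             (auto intro!: always_eventually continuous_on_subset[OF K_cont[OF f]])
      qed
      fix t :: real assume t: "t \<ge> 0"
      have "(\<lambda>k. f k t) \<longlonglongrightarrow> g t" using tendsto_uniform_limitI[OF lim, of t t] t by auto
      then show "a \<le> g t" "g t \<le> a * exp (c * t)"
        using K_lower[OF f t] K_upper[OF f t] by (auto intro: LIMSEQ_le_const LIMSEQ_le_const2)
    qed
    show "\<exists>L. \<forall>g\<in>K. \<forall>h\<in>K. \<forall>t\<in>{0..T}. \<forall>D. (\<forall>s\<in>{0..t}. \<bar>g s - h s\<bar> \<le> D) \<longrightarrow> \<bar>F g t - F h t\<bar> \<le> L * D"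
      if T: "T \<ge> 0" for T
    proof -
      \<comment> \<open>On \<open>{0..T}\<close> functions in \<open>K\<close> take values in
        \<open>{a..M}\<close>, hence their means lie in \<open>{m1..M1}\<close> with
        \<open>m1 > 0\<close>. Both the power \<open>p\<close> and the \<open>n\<close>-th root are
        Lipschitz on these compact intervals, which gives the constant
        \<open>L2 * L1\<close>.\<close>
      define M where "M = a * exp (c * T)"
      have M: "a * exp (c * t) \<le> M" if "t \<in> {0..T}" for t
        using that a c by (auto simp: M_def)
      then have "M > 0" using a by (simp add: M_def)
      define m1 M1 where "m1 = min (a powr p) (M powr p)" and "M1 = max (a powr p) (M powr p)"
      have "m1 > 0" using a \<open>M > 0\<close> by (auto simp: m1_def)
      obtain L1 where L1: "L1 \<ge> 0" "\<And>x y. x \<in> {a..M} \<Longrightarrow> y \<in> {a..M} \<Longrightarrow> \<bar>x powr p - y powr p\<bar> \<le> L1 * \<bar>x - y\<bar>"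
        using powr_lipschitz_on_interval[OF a, of M p] by blast
      obtain L2 where L2: "L2 \<ge> 0" "\<And>x y. x \<in> {m1..M1} \<Longrightarrow> y \<in> {m1..M1} \<Longrightarrow> \<bar>x powr (1/n) - y powr (1/n)\<bar> \<le> L2 * \<bar>x - y\<bar>"
        using powr_lipschitz_on_interval[OF \<open>m1 > 0\<close>, of M1 "1/n"] by blast
      have "\<bar>F g t - F h t\<bar> \<le> L2 * L1 * D"
        if gh: "g \<in> K" "h \<in> K" and t: "t \<in> {0..T}" and D: "\<forall>s\<in>{0..t}. \<bar>g s - h s\<bar> \<le> D" for g h t D
      proof -
        have range: "f s \<in> {a..M}" if "f \<in> K" "s \<in> {0..t}" for f s
          using K_lower[OF that(1)] K_upper[OF that(1)] that(2) t order_trans[OF K_upper[OF that(1)] M] by auto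
        have "\<bar>A g t - A h t\<bar> \<le> L1 * D"
          unfolding A_def
        proof (rule radial_mean_dist[OF n powr_cont powr_cont])
          fix s assume s: "s \<in> {0..t}"
          have "\<bar>g s powr p - h s powr p\<bar> \<le> L1 * \<bar>g s - h s\<bar>"
            using L1(2) range gh s by blast
          also have "\<dots> \<le> L1 * D" using D s L1(1) by (intro mult_left_mono) auto
          finally show "\<bar>g s powr p - h s powr p\<bar> \<le> L1 * D" .
        qed (use gh t in auto)
        then have "L2 * \<bar>A g t - A h t\<bar> \<le> L2 * (L1 * D)"
          using L2(1) by (intro mult_left_mono)
        moreover have "\<bar>F g t - F h t\<bar> \<le> L2 * \<bar>A g t - A h t\<bar>"
          unfolding F_def using A_bounds[of _ t M] gh t M[OF t]
          by (intro L2(2)) (auto simp: m1_def M1_def)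
        ultimately show ?thesis by (simp add: mult.assoc)
      qed
      then show ?thesis by blast
    qed
  qed (fact K_cont F_cont)+
  then obtain g where gK: "g \<in> K" and g: "\<And>t. t \<ge> 0 \<Longrightarrow> g t = a + integral {0..t} (F g)" by blast
  have g_pos: "g t > 0" if "t \<ge> 0" for t using K_lower[OF gK that] a by simp
  have g_deriv: "(g has_real_derivative F g t) (at t within {0..})" if "t \<ge> 0" for t
  proof -
    have "((\<lambda>t. a + integral {0..t} (F g)) has_real_derivative F g t) (at t within {0..})"
      using has_real_derivative_integral_atLeast[OF F_cont[OF gK] that]
      by (auto intro!: derivative_eq_intros)
    then show ?thesis
      by (rule has_field_derivative_transform_within[where d = 1]) (use that g in auto)
  qed
  \<comment> \<open>Regularity is gained in stages: \<open>g\<close> has the continuous derivative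
    \<open>F g\<close>, so its power has the continuous derivative \<open>h'\<close>, so the mean
    \<open>A g\<close> has derivative \<open>A'\<close>, and finally its root \<open>F g\<close> has
    derivative \<open>\<psi>\<close>.\<close>
  define h' where "h' t = p * g t powr (p - 1) * F g t" for t
  have h_deriv: "((\<lambda>t. g t powr p) has_real_derivative h' t) (at t within {0..})" if "t \<ge> 0" for t
    unfolding h'_def
    by (rule DERIV_chain2[OF has_real_derivative_powr[OF g_pos[OF that]] g_deriv[OF that]])
  have h'_cont: "continuous_on {0..} h'"
    unfolding h'_def[abs_def] using g_pos
    by (intro continuous_intros K_cont[OF gK] F_cont[OF gK]) force
  define A' where "A' t = n / (n + 2) * radial_mean (n + 2) h' t" for t
  have A_deriv: "(A g has_real_derivative A' t) (at t within {0..})" if "t \<ge> 0" for t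
    unfolding A_def A'_def by (rule radial_mean_has_derivative[OF h_deriv h'_cont n that])
  define \<psi> where "\<psi> t = 1 / n * A g t powr (1 / n - 1) * A' t" for t
  have F_deriv: "(F g has_real_derivative \<psi> t) (at t within {0..})" if "t \<ge> 0" for t
    unfolding F_def \<psi>_def
    by (rule DERIV_chain2[OF has_real_derivative_powr[OF A_pos[OF gK that]] A_deriv[OF that]])
  have \<psi>_cont: "continuous_on {0..} \<psi>"
  proof -
    have "continuous_on {0..} A'"
      unfolding A'_def[abs_def] by (intro continuous_intros continuous_on_radial_mean[OF h'_cont])
    moreover have "continuous_on {0..} (A g)"
      unfolding A_def by (rule continuous_on_radial_mean[OF powr_cont[OF gK]])
    ultimately show ?thesis
      unfolding \<psi>_def[abs_def] using A_pos[OF gK] by (intro continuous_intros) force+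
  qed
  have "F g t ^ (n - 1) * (F g t + 2 * t * \<psi> t) = g t powr p" if t: "t \<ge> 0" for t
  proof -
    \<comment> \<open>With \<open>\<phi> = F g\<close>, the relation \<open>\<phi> ^ n = A g\<close>
      differentiates to \<open>n * \<phi> ^ (n - 1) * \<psi> = A'\<close>. Facts \<open>1\<close>
      and \<open>2\<close> are these two relations, and \<open>radial_mean_ode\<close> closes the
      computation.\<close>
    let ?x = "A g t"
    have x: "?x > 0" using A_pos[OF gK t] .
    have pow: "F g t ^ (n - 1) = ?x powr (1 - 1 / n)"
      using x n by (simp add: F_def powr_power of_nat_diff diff_divide_distrib)
    have 1: "F g t ^ (n - 1) * F g t = ?x"
      unfolding pow unfolding F_def using x by (simp flip: powr_add)
    have 2: "F g t ^ (n - 1) * \<psi> t = A' t / n"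
    proof -
      have "F g t ^ (n - 1) * \<psi> t = (?x powr (1 - 1 / n) * ?x powr (1 / n - 1)) * (A' t / n)"
        unfolding pow \<psi>_def by simp
      also have "?x powr (1 - 1 / n) * ?x powr (1 / n - 1) = 1"
        using x by (simp flip: powr_add)
      finally show ?thesis by simp
    qed
    have "F g t ^ (n - 1) * (F g t + 2 * t * \<psi> t)
            = F g t ^ (n - 1) * F g t + 2 * t * (F g t ^ (n - 1) * \<psi> t)"
      by (simp add: algebra_simps)
    also have "\<dots> = ?x + 2 * t * (A' t / n)" unfolding 1 2 ..
    also have "\<dots> = ?x + 2 * t / (n + 2) * radial_mean (n + 2) h' t"
      using n by (simp add: A'_def)
    also have "\<dots> = g t powr p"
      unfolding A_def by (rule radial_mean_ode[OF h_deriv h'_cont n t])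
    finally show ?thesis .
  qed
  moreover have "F g t > 0" if "t \<ge> 0" for t
    using A_pos[OF gK that] by (simp add: F_def)
  moreover have "g 0 = a" using g[of 0] by simp
  ultimately show ?thesis
    using \<psi>_cont F_deriv g_deriv K_lower[OF gK]
    by (intro exI[of _ g] exI[of _ "F g"] exI[of _ \<psi>]) auto
qed

section \<open>Radial functions on Euclidean space: determinant, derivatives, convexity\<close>

text \<open>An orthogonal \<open>Q\<close> whose column \<open>k\<close> is the unit vector along
  \<open>x\<close> diagonalises the matrix: \<open>x\<close> is an eigenvector for
  \<open>c + s * (x \<bullet> x)\<close>, and its orthogonal complement belongs to \<open>c\<close>.
  For \<open>x = 0\<close> there is no such direction, but the matrix is already diagonal.\<close>

lemma det_scalar_plus_rank_one:
  fixes x :: "real^'n" and c s :: real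
  shows "det (\<chi> i j. (if i = j then c else 0) + s * (x $ i * x $ j) :: real^'n^'n)
         = c ^ (CARD('n) - 1) * (c + s * (x \<bullet> x))"
    (is "det ?M = _")
proof (cases "x = 0")
  case True
  have "det ?M = c ^ CARD('n)"
    using True by (subst det_diagonal) auto
  also have "\<dots> = c ^ (CARD('n) - 1) * c"
    by (metis One_nat_def power_minus_mult zero_less_card_finite)
  finally show ?thesis using True by simp
next
  case False
  fix k :: 'n
  obtain Q :: "real^'n^'n" where Q: "orthogonal_matrix Q" "Q *v axis k 1 = x /\<^sub>R norm x"
    using False by (rule_tac orthogonal_matrix_exists_basis[of "x /\<^sub>R norm x" k]) auto
  have Qk: "Q $ i $ k = x $ i / norm x" for i
    using arg_cong[OF Q(2), of "\<lambda>v. v $ i"] by (simp add: matrix_vector_mul_component cart_eq_inner_axis[symmetric] inner_axis field_simps)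
  have xQ: "(\<Sum>l\<in>UNIV. x $ l * Q $ l $ j) = (if j = k then norm x else 0)" for j
  proof -
    have "(\<Sum>l\<in>UNIV. Q $ l $ k * Q $ l $ j) = (if j = k then 1 else 0)"
      using Q(1) by (auto simp: orthogonal_matrix_def matrix_matrix_mult_def transpose_def mat_def vec_eq_iff)
    moreover have "x $ l * Q $ l $ j = norm x * (Q $ l $ k * Q $ l $ j)" for l
      using False by (simp add: Qk)
    ultimately show ?thesis by (simp only: sum_distrib_left[symmetric]) simp
  qed
  define D :: "real^'n^'n" where "D = (\<chi> i j. if i = j then (if i = k then c + s * (x \<bullet> x) else c) else 0)"
  have "?M ** Q = Q ** D"
  proof (simp add: vec_eq_iff, intro allI)
    fix i j
    have "(?M ** Q) $ i $ j = (\<Sum>l\<in>UNIV. ((if i = l then c else 0) + s * (x $ i * x $ l)) * Q $ l $ j)"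
      by (simp add: matrix_matrix_mult_def)
    also have "\<dots> = (\<Sum>l\<in>UNIV. (if i = l then c * Q $ l $ j else 0) + s * x $ i * (x $ l * Q $ l $ j))"
      by (rule sum.cong) (auto simp: algebra_simps)
    also have "\<dots> = (\<Sum>l\<in>UNIV. (if i = l then c * Q $ l $ j else 0)) + s * x $ i * (\<Sum>l\<in>UNIV. x $ l * Q $ l $ j)"
      by (simp only: sum.distrib sum_distrib_left)
    \<comment> \<open>Only column \<open>k\<close> sees the rank one term, and there
      \<open>x $ i * norm x = (x \<bullet> x) * Q $ i $ k\<close>.\<close>
    also have "\<dots> = c * Q $ i $ j + (if j = k then s * (x \<bullet> x) * Q $ i $ j else 0)"
      using False by (simp add: xQ Qk dot_square_norm power2_eq_square)
    also have "\<dots> = (\<Sum>l\<in>UNIV. if l = j then Q $ i $ j * (c + (if j = k then s * (x \<bullet> x) else 0)) else 0)"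
      by (simp add: algebra_simps)
    also have "\<dots> = (Q ** D) $ i $ j"
      unfolding matrix_matrix_mult_def D_def vec_lambda_beta by (rule sum.cong) auto
    finally show "(?M ** Q) $ i $ j = (Q ** D) $ i $ j" .
  qed
  then have "det (?M ** Q) = det (Q ** D)" by (rule arg_cong)
  then have "det ?M * det Q = det Q * det D" by (simp only: det_mul)
  moreover have "det Q \<noteq> 0" using det_orthogonal_matrix[OF Q(1)] by auto
  ultimately have "det ?M = det D" by simp
  also have "\<dots> = (\<Prod>i\<in>UNIV. if i = k then c + s * (x \<bullet> x) else c)"
    unfolding D_def by (subst det_diagonal) auto
  also have "\<dots> = (c + s * (x \<bullet> x)) * (\<Prod>i\<in>UNIV - {k}. if i = k then c + s * (x \<bullet> x) else c)"
    by (subst prod.remove[of UNIV k]) auto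
  also have "(\<Prod>i\<in>UNIV - {k}. if i = k then c + s * (x \<bullet> x) else c) = (\<Prod>i\<in>UNIV - {k}. c)"
    by (rule prod.cong) auto
  finally show ?thesis by (simp add: card_Diff_singleton mult.commute)
qed

text \<open>Since \<open>r\<^sup>2 / 2\<close> never leaves \<open>{0..}\<close>, a one-sided
  derivative of \<open>f\<close> at \<open>0\<close> is enough for a two-sided derivative in
  \<open>r\<close>.\<close>

lemma has_real_derivative_compose_half_square:
  fixes r :: real
  assumes "\<And>t. t \<ge> 0 \<Longrightarrow> (f has_real_derivative f' t) (at t within {0..})"
  shows "((\<lambda>r. f (r\<^sup>2 / 2)) has_real_derivative r * f' (r\<^sup>2 / 2)) (at r)"
proof -
  have "((\<lambda>r. f (r\<^sup>2 / 2)) has_derivative (\<lambda>y. f' (r\<^sup>2 / 2) * (r * y))) (at r within UNIV)"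
    by (rule has_derivative_in_compose2[where t = "{0..}" and g' = "\<lambda>t y. f' t * y"])
       (auto intro!: derivative_eq_intros assms[unfolded has_field_derivative_def])
  moreover have "(\<lambda>y. f' (r\<^sup>2 / 2) * (r * y)) = (*) (r * f' (r\<^sup>2 / 2))"
    by (simp add: fun_eq_iff)
  ultimately show ?thesis by (simp add: has_field_derivative_def)
qed

lemma has_derivative_compose_half_norm_square:
  fixes x :: "'a::real_inner"
  assumes "\<And>t. t \<ge> 0 \<Longrightarrow> (f has_real_derivative f' t) (at t within {0..})"
  shows "((\<lambda>x. f (x \<bullet> x / 2)) has_derivative (\<lambda>y. f' (x \<bullet> x / 2) * (x \<bullet> y))) (at x)"
proof -
  have "((\<lambda>x. x \<bullet> x / 2) has_derivative (\<lambda>y. x \<bullet> y)) (at x within UNIV)"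
    by (auto intro!: derivative_eq_intros simp: inner_commute)
  then have "((\<lambda>x. f (x \<bullet> x / 2)) has_derivative (\<lambda>y. f' (x \<bullet> x / 2) * (x \<bullet> y))) (at x within UNIV)"
    by (rule has_derivative_in_compose2[where t = "{0..}" and g' = "\<lambda>t. (*) (f' t)", rotated 3])
       (use assms in \<open>auto simp: has_field_derivative_def\<close>)
  then show ?thesis by simp
qed

lemma convex_on_compose_norm:
  fixes f :: "real \<Rightarrow> real"
  assumes "convex_on {0..} f" "mono_on {0..} f"
  shows "convex_on UNIV (\<lambda>x :: 'a::real_normed_vector. f (norm x))"
proof (rule convex_onI)
  fix t :: real and x y :: 'a
  assume t: "0 < t" "t < 1"
  have "norm ((1 - t) *\<^sub>R x + t *\<^sub>R y) \<le> (1 - t) * norm x + t * norm y"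
    using norm_triangle_ineq[of "(1 - t) *\<^sub>R x" "t *\<^sub>R y"] t by simp
  then have "f (norm ((1 - t) *\<^sub>R x + t *\<^sub>R y)) \<le> f ((1 - t) * norm x + t * norm y)"
    using t by (intro mono_onD[OF assms(2)]) auto
  also have "\<dots> \<le> (1 - t) * f (norm x) + t * f (norm y)"
    using convex_onD[OF assms(1), of t "norm x" "norm y"] t by simp
  finally show "f (norm ((1 - t) *\<^sub>R x + t *\<^sub>R y)) \<le> (1 - t) * f (norm x) + t * f (norm y)" .
qed simp

text \<open>The product rule applied to the gradient produces the Hessian, a multiple of the
  identity plus a rank one term. Since \<open>x \<bullet> x = 2 * t\<close> for
  \<open>t = x \<bullet> x / 2\<close>, its determinant is exactly the left side of
  \<open>ode\<close>.\<close>

lemma radial_MA_solution: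
  fixes g \<phi> \<psi> :: "real \<Rightarrow> real"
  assumes g: "\<And>t. t \<ge> 0 \<Longrightarrow> (g has_real_derivative \<phi> t) (at t within {0..})"
    and \<phi>: "\<And>t. t \<ge> 0 \<Longrightarrow> (\<phi> has_real_derivative \<psi> t) (at t within {0..})"
    and \<psi>: "continuous_on {0..} \<psi>"
    and ode: "\<And>t. t \<ge> 0 \<Longrightarrow> \<phi> t ^ (CARD('n) - 1) * (\<phi> t + 2 * t * \<psi> t) = g t powr p"
  shows "MA_entire_solution p (\<lambda>x :: real^'n. g (x \<bullet> x / 2)) (\<lambda>x. \<phi> (x \<bullet> x / 2) *\<^sub>R x)
          (\<lambda>x. \<chi> i j. (if i = j then \<phi> (x \<bullet> x / 2) else 0) + \<psi> (x \<bullet> x / 2) * (x $ i * x $ j))"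
    (is "MA_entire_solution p ?u ?Du ?H")
  unfolding MA_entire_solution_def
proof (intro conjI allI)
  fix x :: "real^'n"
  show "(?u has_derivative (\<lambda>h. ?Du x \<bullet> h)) (at x)"
    using has_derivative_compose_half_norm_square[OF g] by simp
  have "?H x *v h = \<phi> (x \<bullet> x / 2) *\<^sub>R h + (\<psi> (x \<bullet> x / 2) * (x \<bullet> h)) *\<^sub>R x" for h
  proof (simp only: vec_eq_iff, intro allI)
    fix i
    have "(?H x *v h) $ i = (\<Sum>j\<in>UNIV. (if i = j then \<phi> (x \<bullet> x / 2) * h $ j else 0)
            + \<psi> (x \<bullet> x / 2) * x $ i * (x $ j * h $ j))"
      unfolding matrix_vector_mult_def vec_lambda_beta
      by (rule sum.cong) (auto simp: algebra_simps)
    also have "\<dots> = \<phi> (x \<bullet> x / 2) * h $ i + \<psi> (x \<bullet> x / 2) * x $ i * (x \<bullet> h)"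
      unfolding sum.distrib sum_distrib_left[symmetric] by (simp add: inner_vec_def)
    finally show "(?H x *v h) $ i = (\<phi> (x \<bullet> x / 2) *\<^sub>R h + (\<psi> (x \<bullet> x / 2) * (x \<bullet> h)) *\<^sub>R x) $ i"
      by simp
  qed
  moreover have "(?Du has_derivative (\<lambda>h. \<phi> (x \<bullet> x / 2) *\<^sub>R h + (\<psi> (x \<bullet> x / 2) * (x \<bullet> h)) *\<^sub>R x)) (at x)"
    by (rule has_derivative_scaleR[OF has_derivative_compose_half_norm_square[OF \<phi>] has_derivative_ident])
  ultimately show "(?Du has_derivative (\<lambda>h. ?H x *v h)) (at x)"
    by simp
  show "det (?H x) = ?u x powr p"
    using ode[of "x \<bullet> x / 2"] by (subst det_scalar_plus_rank_one) (simp add: mult.commute)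
next
  have "continuous_on {0..} \<phi>"
    by (rule DERIV_continuous_on) (use \<phi> in auto)
  then have "continuous_on UNIV (\<lambda>x :: real^'n. \<phi> (x \<bullet> x / 2))"
    by (rule continuous_on_compose2) (auto intro!: continuous_intros)
  moreover have "continuous_on UNIV (\<lambda>x :: real^'n. \<psi> (x \<bullet> x / 2))"
    by (rule continuous_on_compose2[OF \<psi>]) (auto intro!: continuous_intros)
  moreover from calculation(1) have "continuous_on UNIV (\<lambda>x :: real^'n. if i = j then \<phi> (x \<bullet> x / 2) else 0)" for i j :: 'n
    by (cases "i = j") auto
  ultimately show "continuous_on UNIV ?H"
    by (intro continuous_intros)
qed

text \<open>Along a ray the profile is \<open>g (r\<^sup>2 / 2)\<close>. Its slope
  \<open>r * \<phi> t\<close> is nonnegative and its second derivative is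
  \<open>\<phi> t + 2 * t * \<psi> t\<close>, where \<open>t = r\<^sup>2 / 2\<close>. So it is
  nondecreasing and convex on \<open>{0..}\<close>, and composing it with the norm gives a convex
  function.\<close>

lemma radial_profile_convex:
  fixes g \<phi> \<psi> :: "real \<Rightarrow> real"
  assumes g: "\<And>t. t \<ge> 0 \<Longrightarrow> (g has_real_derivative \<phi> t) (at t within {0..})"
    and \<phi>: "\<And>t. t \<ge> 0 \<Longrightarrow> (\<phi> has_real_derivative \<psi> t) (at t within {0..})"
    and pos: "\<And>t. t \<ge> 0 \<Longrightarrow> \<phi> t \<ge> 0" "\<And>t. t \<ge> 0 \<Longrightarrow> \<phi> t + 2 * t * \<psi> t \<ge> 0"
  shows "convex_on UNIV (\<lambda>x :: 'a::real_inner. g (x \<bullet> x / 2))"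
proof -
  let ?f = "\<lambda>r. g (r\<^sup>2 / 2)"
  have 1: "(?f has_real_derivative r * \<phi> (r\<^sup>2 / 2)) (at r)" for r
    by (rule has_real_derivative_compose_half_square[OF g])
  have 2: "((\<lambda>r. r * \<phi> (r\<^sup>2 / 2)) has_real_derivative \<phi> (r\<^sup>2 / 2) + 2 * (r\<^sup>2 / 2) * \<psi> (r\<^sup>2 / 2)) (at r)" for r
    by (rule DERIV_cong[OF DERIV_mult[OF DERIV_ident has_real_derivative_compose_half_square[OF \<phi>]]])
       (simp_all add: power2_eq_square)
  have "convex_on {0..} ?f"
    by (rule f''_ge0_imp_convex[OF convex_real_interval(1) 1 2 pos(2)]) simp
  moreover have "mono_on {0..} ?f"
  proof (rule mono_onI)
    fix r s :: real assume rs: "r \<in> {0..}" "r \<le> s"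
    show "?f r \<le> ?f s"
    proof (rule DERIV_nonneg_imp_nondecreasing[OF rs(2)])
      fix x assume "r \<le> x"
      then have "0 \<le> x * \<phi> (x\<^sup>2 / 2)"
        using rs(1) by (intro mult_nonneg_nonneg pos(1)) auto
      with 1 show "\<exists>y. (?f has_real_derivative y) (at x) \<and> 0 \<le> y" by blast
    qed
  qed
  ultimately have "convex_on UNIV (\<lambda>x :: 'a. ?f (norm x))"
    by (rule convex_on_compose_norm)
  then show ?thesis by (simp add: dot_square_norm)
qed

section \<open>Solutions with prescribed minimum and their affine inequivalence\<close>

lemma MA_entire_solution_exists:
  fixes p a :: real
  assumes "p \<le> real CARD('n::finite)" "a > 0"
  shows "\<exists>(u :: real^'n \<Rightarrow> real) Du H. (\<forall>x. a \<le> u x) \<and> convex_on UNIV u \<and>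
           MA_entire_solution p u Du H \<and> u 0 = a \<and> Du 0 = 0"
proof -
  obtain g \<phi> \<psi> where g0: "g 0 = a" and \<psi>: "continuous_on {0..} \<psi>"
    and *: "\<And>t. t \<ge> 0 \<Longrightarrow> a \<le> g t" "\<And>t. t \<ge> 0 \<Longrightarrow> 0 < \<phi> t"
      "\<And>t. t \<ge> 0 \<Longrightarrow> (g has_real_derivative \<phi> t) (at t within {0..})"
      "\<And>t. t \<ge> 0 \<Longrightarrow> (\<phi> has_real_derivative \<psi> t) (at t within {0..})"
      "\<And>t. t \<ge> 0 \<Longrightarrow> \<phi> t ^ (CARD('n) - 1) * (\<phi> t + 2 * t * \<psi> t) = g t powr p"
    using radial_ode_existence[OF zero_less_card_finite assms] by blast
  have "\<phi> t + 2 * t * \<psi> t \<ge> 0" if "t \<ge> 0" for t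
  proof -
    \<comment> \<open>The equation itself gives convexity in the radial direction: its right side is
      nonnegative and \<open>\<phi> t\<close> is positive, which fixes the sign of the remaining
      factor.\<close>
    have "0 \<le> \<phi> t ^ (CARD('n) - 1) * (\<phi> t + 2 * t * \<psi> t)" using *(5)[OF that] by simp
    then show ?thesis using zero_less_power[OF *(2)[OF that]] by (simp only: zero_le_mult_iff) (meson not_less)
  qed
  then have "convex_on UNIV (\<lambda>x :: real^'n. g (x \<bullet> x / 2))"
    by (intro radial_profile_convex[OF *(3,4)] less_imp_le[OF *(2)])
  moreover have "a \<le> g (x \<bullet> x / 2)" for x :: "real^'n"
    by (rule *(1)) simp
  ultimately show ?thesis
    using radial_MA_solution[OF *(3,4) \<psi> *(5)] g0
    by (intro exI[of _ "\<lambda>x. g (x \<bullet> x / 2)"] exI[of _ "\<lambda>x. \<phi> (x \<bullet> x / 2) *\<^sub>R x"] exI conjI allI) simp_all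
qed

text \<open>An invertible affine map is onto, so precomposing with it leaves the set of values
  unchanged.\<close>

lemma affinely_equivalent_range:
  assumes "affinely_equivalent u v"
  shows "range v = range u"
proof -
  obtain A b where A: "invertible A" and v: "\<And>x. v x = u (A *v x + b)"
    using assms by (auto simp: affinely_equivalent_def)
  obtain B where "A ** B = mat 1"
    using A by (auto simp: invertible_def)
  then have "v (B *v (y - b)) = u y" for y
    by (simp add: v matrix_vector_mul_assoc)
  then show ?thesis by (auto simp: v) (metis rangeI)
qed

theorem theorem1p4:
  fixes p :: real
  assumes n2: "CARD('n::finite) \<ge> 2"
      and pn: "p < real CARD('n)"
  shows "(\<forall>a0 > 0. \<exists>(u :: real^'n \<Rightarrow> real) Du H.
            (\<forall>x. u x > 0) \<and> convex_on UNIV u \<and> MA_entire_solution p u Du H \<and>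
            u 0 = a0 \<and> Du 0 = 0)
       \<and> (\<exists>S :: (real^'n \<Rightarrow> real) set. infinite S \<and>
            (\<forall>u\<in>S. pos_convex_entire_solution p u) \<and>
            (\<forall>u\<in>S. \<forall>v\<in>S. u \<noteq> v \<longrightarrow> \<not> affinely_equivalent u v))"
proof -
  have ex: "\<exists>(u :: real^'n \<Rightarrow> real) Du H. (\<forall>x. a \<le> u x) \<and> convex_on UNIV u \<and>
           MA_entire_solution p u Du H \<and> u 0 = a \<and> Du 0 = 0" if "a > 0" for a
    using pn that by (intro MA_entire_solution_exists) auto
  then have "\<forall>a\<in>{0<..}. \<exists>(u :: real^'n \<Rightarrow> real) Du H. (\<forall>x. a \<le> u x) \<and> convex_on UNIV u \<and>
           MA_entire_solution p u Du H \<and> u 0 = a \<and> Du 0 = 0" by simp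
  then obtain U :: "real \<Rightarrow> real^'n \<Rightarrow> real" where U: "\<forall>a\<in>{0<..}. \<exists>Du H. (\<forall>x. a \<le> U a x) \<and> convex_on UNIV (U a) \<and>
           MA_entire_solution p (U a) Du H \<and> U a 0 = a \<and> Du 0 = 0"
    by (rule bchoice[THEN exE])
  \<comment> \<open>The lower bound \<open>a\<close> is attained at the origin, so the parameter can
    be read off from the range. This makes \<open>U\<close> injective and, the range being an affine
    invariant, separates the equivalence classes.\<close>
  have U_min: "Inf (range (U a)) = a" if "a > 0" for a
    using U that by (intro cInf_eq_minimum) (auto, metis rangeI greaterThan_iff)
  have "inj_on U {0<..}"
    by (rule inj_onI) (metis U_min greaterThan_iff)
  then have "infinite (U ` {0<..})"
    by (simp add: finite_image_iff infinite_Ioi)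
  moreover have "pos_convex_entire_solution p (U a)" if "a > 0" for a
    using U that unfolding pos_convex_entire_solution_def by (meson greaterThan_iff less_le_trans)
  moreover have "\<not> affinely_equivalent (U a) (U b)" if "a > 0" "b > 0" "U a \<noteq> U b" for a b
    using that affinely_equivalent_range U_min by metis
  moreover have "\<exists>(u :: real^'n \<Rightarrow> real) Du H. (\<forall>x. u x > 0) \<and> convex_on UNIV u \<and> MA_entire_solution p u Du H \<and>
            u 0 = a \<and> Du 0 = 0" if "a > 0" for a
    using ex[OF that] that less_le_trans[of 0 a] by blast
  ultimately show ?thesis
    by (intro conjI exI[of _ "U ` {0<..}"]) auto
qed

end
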